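(* Let $p_n$ denote the $n$th prime, $n = 1, 2, 3, \ldots$ (so $p_1 = 2$, $p_2 = 3$, and so on). There exists a real constant $h_1$ whose decimal expansion begins $h_1 = 1.2148208055243337469\ldots$ such that the sequence $(h_n)_{n \ge 1}$ of real numbers defined from $h_1$ by the recursion $$h_n = \lceil h_{n-1} \rceil \left( h_{n-1} - \lceil h_{n-1} \rceil + 2 \right) \qquad (n \ge 2)$$ satisfies $\lceil h_n \rceil = p_n$ for every integer $n \ge 1$.
   Context: $\lceil x \rceil$ denotes the ceiling of the real number $x$, i.e. the least integer greater than or equal to $x$. The notation $1.2148208055243337469\ldots$ means that the displayed digits are the initial digits of the decimal expansion of $h_1$. *)

theory Defs
  imports Complex_Main "HOL-Library.Infinite_Set" "HOL-Computational_Algebra.Primes"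
begin

text \<open>Indexed from 1, so that \<open>nth_prime 1 = 2\<close>, whereas \<open>enumerate\<close> counts from 0.
  The value at 0 is irrelevant.\<close>
definition nth_prime :: "nat \<Rightarrow> nat" where
  "nth_prime n = enumerate {p. prime p} (n - 1)"

text \<open>The digit in the \<open>i\<close>-th place after the decimal point of a nonnegative real
  (for \<open>i \<ge> 1\<close>), truncating rather than rounding.\<close>
definition decimal_digit :: "real \<Rightarrow> nat \<Rightarrow> int" where
  "decimal_digit x i = \<lfloor>x * 10 ^ i\<rfloor> mod 10"

end

theory Submission
  imports Defs "HOL-Library.Discrete_Functions"
begin

text \<open>
  Write \<open>p\<^sub>k\<close> for the primes and look for a solution of the form \<open>h\<^sub>k = p\<^sub>k - 1 + t\<^sub>k\<close>. The condition
  \<open>\<lceil>h\<^sub>k\<rceil> = p\<^sub>k\<close> says exactly that \<open>0 < t\<^sub>k \<le> 1\<close>, and under this condition the recursion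
  becomes \<open>p\<^sub>k * t\<^sub>k = (p\<^sub>k\<^sub>+\<^sub>1 - p\<^sub>k - 1) + t\<^sub>k\<^sub>+\<^sub>1\<close>. This is the relation between the tails of a Cantor
  series, that is, of an expansion in the varying base \<open>p\<^sub>1, p\<^sub>2, \<dots>\<close> whose digits are the prime gaps
  minus one. So \<open>t\<^sub>1\<close> has to be the sum of \<open>(p\<^sub>k\<^sub>+\<^sub>1 - p\<^sub>k - 1) / (p\<^sub>1 * \<dots> * p\<^sub>k)\<close>, and the only
  question is whether the digits are admissible, i.e. lie between \<open>0\<close> and \<open>p\<^sub>k - 1\<close>. The upper bound
  is \<open>p\<^sub>k\<^sub>+\<^sub>1 \<le> 2 * p\<^sub>k\<close>, which is Bertrand's postulate. Strict positivity of the tails holds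
  because every gap after the first one is at least \<open>2\<close>, so that no two consecutive digits vanish.

  Bertrand's postulate (lemma \<open>bertrand\<close>) is proved by Erdos' argument: without a
  prime in \<open>(n, 2 * n]\<close> the central binomial coefficient would have only prime factors up to
  \<open>2 * n / 3\<close>, and then it is too small (lemmas \<open>primorial_le\<close>, \<open>prime_power_central_binomial_le\<close>,
  \<open>multiplicity_central_binomial_eq_0\<close>). The digit expansion is lemma \<open>cantor_series_expansion\<close>.

  For the decimal digits of \<open>h\<^sub>1 = 1 + t\<^sub>1\<close>, sixteen steps of the recursion express \<open>t\<^sub>1\<close> through \<open>t\<^sub>1\<^sub>7\<close>
  with coefficient \<open>1 / (2 * 3 * \<dots> * 53)\<close>, which is less than \<open>10\<close> to the power \<open>-19\<close>. This is
  small enough for \<open>0 < t\<^sub>1\<^sub>7 \<le> 1\<close> to fix all the digits in question.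
\<close>

section \<open>The product of the primes up to a bound\<close>

lemma prod_primes_dvd:
  fixes A :: "nat set"
  assumes "finite A" "\<And>p. p \<in> A \<Longrightarrow> prime p" "\<And>p. p \<in> A \<Longrightarrow> p dvd n"
  shows "\<Prod>A dvd n"
  using assms
proof (induction A rule: finite_induct)
  case (insert p A)
  have "coprime p (\<Prod>A)"
    using insert by (intro prod_coprime_right) (metis insertCI primes_coprime)
  then show ?case
    using insert by (simp add: divides_mult)
qed simp

text \<open>
  The two middle coefficients of row \<open>2 * m + 1\<close> are equal, and together they are at most the row
  sum \<open>2 * 4 ^ m\<close>.
\<close>

lemma binomial_middle_odd_le: "(2 * m + 1) choose m \<le> 4 ^ m"
proof -
  have "(2 * m + 1 choose m) + (2 * m + 1 choose (m + 1)) = (\<Sum>k\<in>{m, m + 1}. 2 * m + 1 choose k)"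
    by simp
  also have "\<dots> \<le> (\<Sum>k\<le>2 * m + 1. 2 * m + 1 choose k)"
    by (intro sum_mono2) auto
  also have "\<dots> = 2 * 4 ^ m"
    by (simp only: choose_row_sum) (simp add: power_mult)
  finally show ?thesis
    using binomial_symmetric[of m "2 * m + 1"] by simp
qed

text \<open>
  All primes in \<open>(m + 1, 2 * m + 1]\<close> divide \<open>(2 * m + 1) choose m\<close>, because they divide the numerator
  of the factorial quotient but not its denominator. This takes the bound from \<open>m + 1\<close> to
  \<open>2 * m + 1\<close>; an even number greater than \<open>2\<close> contributes no prime of its own.
\<close>

lemma primorial_le: "\<Prod>{p. prime p \<and> p \<le> n} \<le> (4::nat) ^ n"
proof (induction n rule: less_induct)
  case (less n)
  consider "n < 2" | "n = 2" | "n > 2" "even n" | m where "n = 2 * m + 1" "m \<ge> 1"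
  proof (cases n "2::nat" rule: linorder_cases)
    case greater
    show ?thesis
    proof (cases "even n")
      case False
      then obtain m where "n = 2 * m + 1"
        by (rule oddE)
      with greater show ?thesis
        by (intro that(4)[of m]) simp_all
    qed (rule that(3)[OF greater])
  qed (rule that(1), assumption, rule that(2))
  then show ?case
  proof cases
    case 1
    then have empty: "{p. prime p \<and> p \<le> n} = {}"
      by (auto dest!: prime_ge_2_nat)
    show ?thesis
      unfolding empty by simp
  next
    case 2
    have two: "{p. prime p \<and> p \<le> n} = {2}"
    proof (intro equalityI subsetI)
      fix p assume "p \<in> {p. prime p \<and> p \<le> n}"
      then show "p \<in> {2}"
        using prime_ge_2_nat[of p] 2 by simp
    qed (simp add: 2)
    show ?thesis
      unfolding two by (simp add: 2)
  next
    case 3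
    then have "\<not> prime n"
      using prime_odd_nat by blast
    then have "prime p \<and> p \<le> n \<longleftrightarrow> prime p \<and> p \<le> n - 1" for p
      using 3 by (cases "p = n") auto
    then have "{p. prime p \<and> p \<le> n} = {p. prime p \<and> p \<le> n - 1}"
      by (rule Collect_cong)
    also have "\<Prod>\<dots> \<le> 4 ^ (n - 1)"
      using 3 by (intro less) auto
    also have "\<dots> \<le> 4 ^ n"
      by (intro power_increasing) auto
    finally show ?thesis .
  next
    case 4
    let ?B = "{p. prime p \<and> m + 1 < p \<and> p \<le> 2 * m + 1}"
    have "p dvd (2 * m + 1 choose m)" if "p \<in> ?B" for p
    proof -
      have "p dvd fact m * fact (m + 1) * (2 * m + 1 choose m)"
        using binomial_fact_lemma[of m "2 * m + 1"] that
        by (simp add: prime_dvd_fact_iff del: fact_Suc)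
      then show ?thesis
        using that by (auto simp: prime_dvd_mult_iff prime_dvd_fact_iff simp del: fact_Suc)
    qed
    then have "\<Prod>?B dvd (2 * m + 1 choose m)"
      by (intro prod_primes_dvd) auto
    then have "\<Prod>?B \<le> (2 * m + 1 choose m)"
      by (rule dvd_imp_le) simp
    then have B: "\<Prod>?B \<le> 4 ^ m"
      using binomial_middle_odd_le[of m] by simp
    have split: "{p. prime p \<and> p \<le> n} = {p. prime p \<and> p \<le> m + 1} \<union> ?B"
      using 4 by auto
    have "\<Prod>{p. prime p \<and> p \<le> n} = \<Prod>{p. prime p \<and> p \<le> m + 1} * \<Prod>?B"
      unfolding split by (rule prod.union_disjoint) auto
    also have "\<dots> \<le> 4 ^ (m + 1) * 4 ^ m"
      by (rule mult_le_mono[OF less B]) (use 4 in simp)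
    also have "\<dots> = 4 ^ n"
      unfolding 4 by (simp add: mult_2 power_add)
    finally show ?thesis .
  qed
qed

section \<open>Prime factors of the central binomial coefficient\<close>

lemma multiplicity_eq_card:
  fixes p m :: nat
  assumes "prime p" "0 < m" "m \<le> N"
  shows "multiplicity p m = card {i \<in> {1..N}. p ^ i dvd m}"
proof -
  have iff: "p ^ i dvd m \<longleftrightarrow> i \<le> multiplicity p m" for i
    using assms(1,2) not_prime_unit[of p] by (subst power_dvd_iff_le_multiplicity) auto
  have "multiplicity p m < p ^ multiplicity p m"
    using prime_gt_1_nat[OF assms(1)] by (intro power_gt_expt) simp
  also have "\<dots> \<le> m"
    using assms by (intro dvd_imp_le multiplicity_dvd) auto
  finally have "multiplicity p m \<le> N"
    using assms(3) by linarith
  then have "{i \<in> {1..N}. p ^ i dvd m} = {1..multiplicity p m}"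
    unfolding iff by auto
  then show ?thesis by simp
qed

lemma Suc_div: "Suc n div d = n div d + (if d dvd Suc n then 1 else 0)"
  by (auto simp: div_Suc dvd_eq_mod_eq_0)

text \<open>
  Legendre's formula. The terms with \<open>p ^ i > n\<close> vanish; summing up to an arbitrary \<open>N \<ge> n\<close> gives
  the formulas for \<open>n\<close> and \<open>2 * n\<close> a common range, so that they can be subtracted term by term.
\<close>

lemma legendre_formula:
  fixes p :: nat
  assumes "prime p" "n \<le> N"
  shows "multiplicity p (fact n) = (\<Sum>i = 1..N. n div p ^ i)"
  using assms(2)
proof (induction n)
  case (Suc n)
  have "multiplicity p (fact (Suc n)) = multiplicity p (Suc n) + multiplicity p (fact n)"
    using assms(1) by (simp add: prime_elem_multiplicity_mult_distrib del: mult_Suc of_nat_Suc)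
  also have "multiplicity p (Suc n) = (\<Sum>i = 1..N. if p ^ i dvd Suc n then 1 else 0)"
    using Suc.prems assms(1)
    by (subst multiplicity_eq_card[where N = N])
       (auto simp: sum.If_cases Int_def intro!: arg_cong[where f = card])
  also have "\<dots> + multiplicity p (fact n) = (\<Sum>i = 1..N. Suc n div p ^ i)"
    using Suc by (simp add: Suc_div sum.distrib del: div_Suc)
  finally show ?case .
qed simp

lemma double_div_le:
  fixes d :: nat
  shows "2 * (n div d) \<le> 2 * n div d"
proof (cases "d = 0")
  case False
  have "2 * (n div d) * d \<le> 2 * n"
    unfolding mult.assoc by (intro mult_le_mono2 div_times_less_eq_dividend)
  with False show ?thesis
    by (simp only: less_eq_div_iff_mult_less_eq)
qed simp

lemma double_div_minus_le_1:
  fixes d :: nat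
  shows "2 * n div d - 2 * (n div d) \<le> 1"
proof (cases "d = 0")
  case False
  then have "n < (n div d + 1) * d"
    by (simp add: dividend_less_times_div mult.commute)
  then have "2 * n < (2 * (n div d) + 2) * d" by simp
  then have "2 * n div d < 2 * (n div d) + 2"
    using False by (simp add: div_less_iff_less_mult)
  then show ?thesis by simp
qed simp

lemma multiplicity_central_binomial:
  fixes p :: nat
  assumes "prime p"
  shows "multiplicity p (2 * n choose n) = (\<Sum>i = 1..2 * n. 2 * n div p ^ i - 2 * (n div p ^ i))"
proof -
  have "fact n * fact n * (2 * n choose n) = (fact (2 * n) :: nat)"
    using binomial_fact_lemma[of n "2 * n"] by (simp add: mult_2)
  moreover have "multiplicity p (fact n * fact n * (2 * n choose n))
      = 2 * multiplicity p (fact n) + multiplicity p (2 * n choose n)"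
    using assms by (simp add: prime_elem_multiplicity_mult_distrib)
  ultimately have "multiplicity p (2 * n choose n)
      = multiplicity p (fact (2 * n)) - 2 * multiplicity p (fact n)"
    by simp
  also have "\<dots> = (\<Sum>i = 1..2 * n. 2 * n div p ^ i) - (\<Sum>i = 1..2 * n. 2 * (n div p ^ i))"
    using assms by (simp add: legendre_formula[where N = "2 * n"] sum_distrib_left)
  also have "\<dots> = (\<Sum>i = 1..2 * n. 2 * n div p ^ i - 2 * (n div p ^ i))"
    by (intro sum_subtractf_nat[symmetric]) (rule double_div_le)
  finally show ?thesis .
qed

text \<open>
  Every term of Legendre's formula for the central binomial coefficient is at most \<open>1\<close>, and it
  vanishes once \<open>p ^ i > 2 * n\<close>. If the multiplicity \<open>c\<close> satisfied \<open>p ^ c > 2 * n\<close>, only the terms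
  with \<open>1 \<le> i < c\<close> could contribute, and their sum would be less than \<open>c\<close>.
\<close>

lemma prime_power_central_binomial_le:
  fixes p :: nat
  assumes "prime p" "n > 0"
  shows "p ^ multiplicity p (2 * n choose n) \<le> 2 * n"
proof (rule ccontr)
  let ?c = "multiplicity p (2 * n choose n)"
  assume *: "\<not> ?thesis"
  have "?c = (\<Sum>i = 1..2 * n. 2 * n div p ^ i - 2 * (n div p ^ i))"
    by (rule multiplicity_central_binomial[OF assms(1)])
  also have "\<dots> \<le> (\<Sum>i = 1..2 * n. if i < ?c then 1 else 0)"
  proof (rule sum_mono)
    fix i
    show "2 * n div p ^ i - 2 * (n div p ^ i) \<le> (if i < ?c then 1 else 0)"
    proof (cases "i < ?c")
      case False
      then have "p ^ ?c \<le> p ^ i"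
        using assms by (intro power_increasing) (auto dest: prime_ge_1_nat)
      with * have "2 * n < p ^ i" by simp
      then show ?thesis by simp
    qed (use double_div_minus_le_1 in auto)
  qed
  also have "\<dots> = card {i \<in> {1..2 * n}. i < ?c}"
    by (simp add: sum.If_cases Int_def)
  also have "\<dots> \<le> card {1..<?c}"
    by (intro card_mono) auto
  finally have "?c = 0" by simp
  with * assms show False by simp
qed

text \<open>
  The key point of Erdos' proof: for \<open>2 * n / 3 < p \<le> n\<close> the only multiples
  of \<open>p\<close> up to \<open>2 * n\<close> are \<open>p\<close> and \<open>2 * p\<close>. As \<open>p > 2\<close>, they contribute two factors \<open>p\<close> to
  \<open>fact (2 * n)\<close>, which are cancelled by the two in \<open>fact n * fact n\<close>.
\<close>

lemma multiplicity_central_binomial_eq_0: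
  fixes p :: nat
  assumes "prime p" "p > 2" "2 * n < 3 * p" "p \<le> n"
  shows "multiplicity p (2 * n choose n) = 0"
proof -
  have "2 * n div p ^ i - 2 * (n div p ^ i) = 0" if "i \<ge> 1" for i
  proof (cases "i = 1")
    case True
    have "2 * n div p < 3" "n div p \<ge> 1"
      using assms by (auto simp: div_less_iff_less_mult less_eq_div_iff_mult_less_eq)
    with True show ?thesis by simp
  next
    case False
    with that have "p ^ 2 \<le> p ^ i"
      using assms by (intro power_increasing) auto
    moreover have "2 * n < p ^ 2"
      using assms(2,3) mult_le_mono1[of 3 p p] unfolding power2_eq_square by linarith
    ultimately show ?thesis by simp
  qed
  then show ?thesis
    by (simp add: multiplicity_central_binomial[OF assms(1)])
qed

section \<open>Bertrand's postulate\<close>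

text \<open>
  This inequality decides from which \<open>n\<close> on the counting argument below works. The value \<open>30\<close> is
  the least one from which the inequality holds throughout. Each step multiplies the left-hand side by at
  most \<open>(11 / 10) ^ 6 < 2\<close>.
\<close>

lemma power_2_ge_Suc_power_6:
  fixes s :: nat
  assumes "s \<ge> 30"
  shows "(s + 1) ^ 6 \<le> 2 ^ s"
  using assms
proof (induction s rule: dec_induct)
  case (step s)
  have "10 ^ 6 * (s + 2) ^ 6 = (10 * (s + 2)) ^ 6"
    by (simp only: power_mult_distrib)
  also have "\<dots> \<le> (11 * (s + 1)) ^ 6"
    using step by (intro power_mono) auto
  also have "\<dots> = 11 ^ 6 * (s + 1) ^ 6"
    by (simp only: power_mult_distrib)
  also have "\<dots> \<le> (2 * 10 ^ 6) * 2 ^ s"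
    using step by (intro mult_mono) auto
  finally show ?case by simp
qed simp

text \<open>
  In the central binomial coefficient \<open>C\<close> a prime up to \<open>s = \<lfloor>sqrt (2 * n)\<rfloor>\<close> contributes at most
  \<open>2 * n\<close>. A larger prime \<open>p\<close> contributes at most \<open>p\<close>, since \<open>p ^ 2 > 2 * n\<close>, and only
  if \<open>p \<le> 2 * n / 3\<close>. With the bound on
  the product of primes this makes \<open>C\<close> roughly \<open>(2 * n) ^ s * 4 ^ (2 * n / 3)\<close> at most, whereas \<open>C\<close> is at
  least \<open>4 ^ n / (2 * n)\<close>. The bound \<open>450\<close> guarantees \<open>s \<ge> 30\<close>.
\<close>

lemma bertrand_ge_450:
  fixes n :: nat
  assumes "n \<ge> 450"
  shows "\<exists>p. prime p \<and> n < p \<and> p \<le> 2 * n"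
proof (rule ccontr)
  assume none: "\<not> ?thesis"
  define s where "s = floor_sqrt (2 * n)"
  define C where "C = (2 * n choose n)"
  define A where "A = {p. prime p \<and> p \<le> s}"
  define B where "B = {p. prime p \<and> s < p \<and> p \<le> 2 * n div 3}"
  have s: "s ^ 2 \<le> 2 * n" "2 * n < (s + 1) ^ 2"
    using Suc_floor_sqrt_power2_gt[of "2 * n"] by (simp_all add: s_def)
  have "s \<ge> 30"
    unfolding s_def using assms by (intro le_floor_sqrtI) simp
  have fin: "finite A" "finite B"
    by (auto simp: A_def B_def)
  have C: "C > 0" by (simp add: C_def)
  \<comment> \<open>No prime factor of \<open>C\<close> exceeds \<open>2 * n div 3\<close>, except that \<open>2\<close>, which is outside the scope
    of the cancellation argument, is covered by \<open>2 \<le> s\<close>.\<close>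
  have sub: "prime_factors C \<subseteq> A \<union> B"
  proof
    fix p assume "p \<in> prime_factors C"
    then have p: "prime p" "p dvd C" by auto
    then have "p dvd fact (2 * n)"
      using binomial_fact_lemma[of n "2 * n"] by (metis C_def dvd_mult le_add2 mult_2)
    then have "p \<le> n"
      using none p by (metis linorder_not_le prime_dvd_fact_iff)
    moreover have "multiplicity p C \<noteq> 0"
      using p C by (simp add: prime_multiplicity_gt_zero_iff)
    ultimately have "p \<le> 2 \<or> 3 * p \<le> 2 * n"
      using multiplicity_central_binomial_eq_0[of p n] p by (force simp: C_def)
    with p \<open>s \<ge> 30\<close> show "p \<in> A \<union> B"
      by (auto simp: A_def B_def)
  qed
  have "C = (\<Prod>p\<in>prime_factors C. p ^ multiplicity p C)"
    using prime_factorization_nat[OF C] .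
  also have "\<dots> = (\<Prod>p\<in>A \<union> B. p ^ multiplicity p C)"
    using fin sub C
    by (intro prod.mono_neutral_left)
       (auto simp: A_def B_def in_prime_factors_iff not_dvd_imp_multiplicity_0)
  also have "\<dots> = (\<Prod>p\<in>A. p ^ multiplicity p C) * (\<Prod>p\<in>B. p ^ multiplicity p C)"
    using fin by (intro prod.union_disjoint) (auto simp: A_def B_def)
  also have "\<dots> \<le> (2 * n) ^ (s - 1) * 4 ^ (2 * n div 3)"
  proof (rule mult_le_mono)
    have "(\<Prod>p\<in>A. p ^ multiplicity p C) \<le> (\<Prod>p\<in>A. 2 * n)"
      using assms by (intro prod_mono) (auto simp: A_def C_def intro!: prime_power_central_binomial_le)
    also have "\<dots> = (2 * n) ^ card A" by simp
    also have "\<dots> \<le> (2 * n) ^ (s - 1)"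
    proof (rule power_increasing)
      have "card A \<le> card {2..s}"
        by (intro card_mono) (auto simp: A_def dest: prime_ge_2_nat)
      then show "card A \<le> s - 1" by simp
    qed (use assms in simp)
    finally show "(\<Prod>p\<in>A. p ^ multiplicity p C) \<le> (2 * n) ^ (s - 1)" .
  next
    have "p ^ multiplicity p C \<le> p" if "p \<in> B" for p
    proof -
      have p: "prime p" "s < p"
        using that by (auto simp: B_def)
      have "p ^ multiplicity p C \<le> 2 * n"
        using p assms unfolding C_def by (intro prime_power_central_binomial_le) auto
      also have "\<dots> < (s + 1) ^ 2" by (rule s)
      also have "\<dots> \<le> p ^ 2"
        using p by (intro power_mono) auto
      finally have "multiplicity p C < 2"
        using prime_gt_1_nat[OF p(1)] by (simp only: power_strict_increasing_iff)
      then have "p ^ multiplicity p C \<le> p ^ 1"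
        using p by (intro power_increasing) (auto dest: prime_ge_1_nat)
      then show ?thesis by simp
    qed
    then have "(\<Prod>p\<in>B. p ^ multiplicity p C) \<le> \<Prod>B"
      by (intro prod_mono) auto
    also have "\<dots> \<le> \<Prod>{p. prime p \<and> p \<le> 2 * n div 3}"
      by (intro dvd_imp_le prod_dvd_prod_subset prod_pos) (auto simp: B_def dest: prime_gt_0_nat)
    also have "\<dots> \<le> 4 ^ (2 * n div 3)" by (rule primorial_le)
    finally show "(\<Prod>p\<in>B. p ^ multiplicity p C) \<le> 4 ^ (2 * n div 3)" .
  qed
  finally have C_le: "C \<le> (2 * n) ^ (s - 1) * 4 ^ (2 * n div 3)" .
  \<comment> \<open>There are at most \<open>s - 1\<close> primes up to \<open>s\<close>; the factor \<open>2 * n\<close> lost in the lower bound for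
    \<open>C\<close> raises the exponent to \<open>s\<close>.\<close>
  have "4 ^ n / (2 * real n) \<le> real C"
    unfolding C_def using assms by (intro central_binomial_lower_bound) simp
  then have "real (4 ^ n) \<le> real (2 * n * C)"
    using assms by (simp add: field_simps)
  then have "4 ^ n \<le> 2 * n * C"
    by (simp only: of_nat_le_iff)
  also have "\<dots> \<le> 2 * n * ((2 * n) ^ (s - 1) * 4 ^ (2 * n div 3))"
    by (intro mult_left_mono C_le) simp
  also have "\<dots> = (2 * n) ^ s * 4 ^ (2 * n div 3)"
    using \<open>s \<ge> 30\<close> by (cases s) simp_all
  finally have "4 ^ n \<le> (2 * n) ^ s * 4 ^ (2 * n div 3)" .
  \<comment> \<open>Cubing clears the denominator \<open>3\<close>; what remains is \<open>2 ^ (2 * n) \<le> (2 * n) ^ (3 * s)\<close>, against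
    \<open>2 * n < (s + 1) ^ 2\<close> and \<open>(s + 1) ^ 6 \<le> 2 ^ s\<close>.\<close>
  then have "(4 ^ n) ^ 3 \<le> ((2 * n) ^ s * 4 ^ (2 * n div 3)) ^ 3"
    by (intro power_mono) simp_all
  also have "\<dots> = (2 * n) ^ (3 * s) * 4 ^ (3 * (2 * n div 3))"
    by (simp only: power_mult_distrib mult.commute flip: power_mult)
  also have "\<dots> \<le> (2 * n) ^ (3 * s) * 4 ^ (2 * n)"
    by (intro mult_left_mono power_increasing) auto
  also have "(2 * n) ^ (3 * s) < ((s + 1) ^ 2) ^ (3 * s)"
    using s \<open>s \<ge> 30\<close> by (intro power_strict_mono) auto
  also have "\<dots> = ((s + 1) ^ 6) ^ s"
    by (simp flip: power_mult)
  also have "\<dots> \<le> (2 ^ s) ^ s"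
    using \<open>s \<ge> 30\<close> by (intro power_mono power_2_ge_Suc_power_6) auto
  also have "\<dots> = 2 ^ (s ^ 2)"
    by (simp add: power2_eq_square flip: power_mult)
  also have "\<dots> \<le> 2 ^ (2 * n)"
    using s by (intro power_increasing) auto
  also have "2 ^ (2 * n) * 4 ^ (2 * n) = ((4::nat) ^ n) ^ 3"
    unfolding power_mult[of 2 2 n] power_even_eq[of 4 n] by (simp add: power2_eq_square power3_eq_cube)
  finally show False by simp
qed

text \<open>
  Trial division up to the square root, in a form that the simplifier can evaluate. It keeps the
  number of divisors to be tried small for the primes used below.
\<close>

lemma prime_natI_sqrt:
  fixes p r :: nat
  assumes "1 < p" "p < r ^ 2" "\<forall>d\<in>set [2..<r]. \<not> d dvd p"
  shows "prime p"
proof (rule ccontr)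
  assume "\<not> prime p"
  then obtain a where a: "a dvd p" "a \<noteq> 1" "a \<noteq> p"
    using assms(1) by (auto simp: prime_nat_iff)
  then obtain b where b: "p = a * b"
    by (elim dvdE)
  have no_divisor: "r \<le> d" if "d dvd p" "d \<noteq> 1" for d
  proof (rule ccontr)
    assume "\<not> r \<le> d"
    moreover have "d \<noteq> 0"
      using that(1) assms(1) by (intro notI) simp
    ultimately have "d \<in> set [2..<r]"
      using that(2) by simp
    with assms(3) that(1) show False by blast
  qed
  have "r * r \<le> a * b"
    using a b by (intro mult_le_mono no_divisor) auto
  with assms(2) b show False
    by (simp add: power2_eq_square)
qed

text \<open>
  Below \<open>450\<close> it suffices to exhibit a chain of primes in which each is less than twice its
  predecessor.
\<close>

lemma bertrand:
  fixes n :: nat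
  assumes "n \<ge> 1"
  shows "\<exists>p. prime p \<and> n < p \<and> p \<le> 2 * n"
proof (cases "n \<ge> 450")
  case False
  have "prime (163::nat)" "prime (317::nat)" "prime (631::nat)"
    by (rule prime_natI_sqrt[where r = 13] prime_natI_sqrt[where r = 18]
        prime_natI_sqrt[where r = 26]; simp)+
  then have "\<forall>q\<in>{2, 3, 5, 7, 13, 23, 43, 83, 163, 317, 631}. prime (q::nat)"
    by (simp del: prime_nat_numeral_eq) simp
  moreover have "\<exists>q\<in>{2, 3, 5, 7, 13, 23, 43, 83, 163, 317, 631}. n < q \<and> q \<le> 2 * n"
    using False assms by simp presburger
  ultimately show ?thesis by blast
qed (rule bertrand_ge_450)

section \<open>Cantor series\<close>

text \<open>
  Expansion with respect to the variable base \<open>q 0, q 1, \<dots>\<close> for a given digit sequence \<open>a\<close>: the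
  number \<open>t k\<close> is the value of the digits from position \<open>k\<close> on. As with ordinary decimals, the largest
  digits \<open>a k = q k - 1\<close> give partial sums that stay below \<open>1\<close>, so every series of digits
  converges to a value in \<open>[0, 1]\<close>.
\<close>

lemma cantor_series_expansion:
  fixes q a :: "nat \<Rightarrow> real"
  assumes q: "\<And>k. q k > 0" and a: "\<And>k. 0 \<le> a k" "\<And>k. a k \<le> q k - 1"
  shows "\<exists>t. \<forall>k. 0 \<le> t k \<and> t k \<le> 1 \<and> q k * t k = a k + t (k + 1)"
proof -
  define c where "c k i = a (k + i) / (\<Prod>j\<le>i. q (k + j))" for k i
  have nonneg: "0 \<le> c k i" for k i
    using q a by (simp add: c_def prod_nonneg less_imp_le)
  \<comment> \<open>By the bound on the digits the series is dominated term by term by a telescoping series.\<close>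
  have partial: "(\<Sum>i<n. c k i) \<le> 1 - 1 / (\<Prod>j<n. q (k + j))" for k n
  proof (induction n)
    case (Suc n)
    define Q where "Q = (\<Prod>j<n. q (k + j))"
    have Q: "(\<Prod>j<Suc n. q (k + j)) = Q * q (k + n)" "(\<Prod>j\<le>n. q (k + j)) = Q * q (k + n)" "Q > 0"
      using q by (simp_all add: Q_def prod_pos flip: lessThan_Suc_atMost)
    have "c k n \<le> (q (k + n) - 1) / (Q * q (k + n))"
      unfolding c_def Q using q[of "k + n"] a Q(3) by (intro divide_right_mono) simp_all
    also have "\<dots> = 1 / Q - 1 / (Q * q (k + n))"
      using q[of "k + n"] Q(3) by (simp add: field_simps)
    finally show ?case
      using Suc.IH unfolding Q Q_def[symmetric] by simp
  qed simp
  have le_1: "(\<Sum>i<n. c k i) \<le> 1" for k n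
    using partial[where k = k and n = n] q by (smt (verit) divide_nonneg_nonneg prod_nonneg)
  have summable: "summable (c k)" for k
    using nonneg le_1 by (rule summableI_nonneg_bounded)
  define t where "t k = (\<Sum>i. c k i)" for k
  show ?thesis
  proof (intro exI[of _ t] allI conjI)
    fix k
    show "0 \<le> t k"
      unfolding t_def by (intro suminf_nonneg summable nonneg)
    show "t k \<le> 1"
      unfolding t_def by (intro suminf_le_const summable le_1)
    show "q k * t k = a k + t (k + 1)"
    proof -
      have "c (Suc k) i = q k * c k (Suc i)" for i
        using q[of k] unfolding c_def by (subst prod.atMost_Suc_shift) simp
      then have "t (Suc k) = q k * (\<Sum>i. c k (Suc i))"
        using summable[of k] by (simp add: t_def suminf_mult summable_Suc_iff)
      also have "\<dots> = q k * (t k - c k 0)"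
        by (simp add: t_def suminf_split_head[OF summable])
      also have "\<dots> = q k * t k - a k"
        using q[of k] by (simp add: c_def right_diff_distrib)
      finally show ?thesis
        by simp
    qed
  qed
qed

section \<open>The sequence of primes\<close>

text \<open>
  Counted from \<open>0\<close>, so that \<open>prime_seq k\<close> is the prime \<open>p\<^sub>k\<^sub>+\<^sub>1\<close> of the informal argument; the tails
  \<open>t k\<close> below are shifted in the same way.
\<close>

abbreviation prime_seq :: "nat \<Rightarrow> nat" where
  "prime_seq \<equiv> enumerate {p. prime p}"

lemma prime_prime_seq: "prime (prime_seq k)"
  using enumerate_in_set[OF primes_infinite] by simp

lemma prime_seq_less_Suc: "prime_seq k < prime_seq (Suc k)"
  by (rule enumerate_step[OF primes_infinite])

lemma prime_seq_Suc_le: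
  assumes "prime p" "prime_seq k < p"
  shows "prime_seq (Suc k) \<le> p"
  unfolding enumerate_Suc''[OF primes_infinite] using assms by (intro Least_le) simp

lemma prime_seq_nextI:
  assumes "prime_seq k = p" "n = Suc k" "prime p'" "p < p'" "\<forall>d\<in>set [Suc p..<p']. \<not> prime d"
  shows "prime_seq n = p'"
proof -
  have "prime_seq n \<le> p'"
    using assms unfolding assms(2) by (intro prime_seq_Suc_le) simp_all
  moreover have "prime_seq n \<notin> set [Suc p..<p']"
    using assms(5) prime_prime_seq[of n] by blast
  moreover have "p < prime_seq n"
    using prime_seq_less_Suc[of k] assms(1,2) by simp
  ultimately show ?thesis by simp
qed

lemma prime_seq_0: "prime_seq 0 = 2"
  unfolding enumerate_0 by (intro Least_equality) (auto dest: prime_ge_2_nat)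

lemma prime_seq_values:
  "prime_seq 0 = 2"
  "prime_seq (Suc 0) = 3"
  "prime_seq 2 = 5"
  "prime_seq 3 = 7"
  "prime_seq 4 = 11"
  "prime_seq 5 = 13"
  "prime_seq 6 = 17"
  "prime_seq 7 = 19"
  "prime_seq 8 = 23"
  "prime_seq 9 = 29"
  "prime_seq 10 = 31"
  "prime_seq 11 = 37"
  "prime_seq 12 = 41"
  "prime_seq 13 = 43"
  "prime_seq 14 = 47"
  "prime_seq 15 = 53"
  "prime_seq 16 = 59"
proof -
  show p0: "prime_seq 0 = 2" by (rule prime_seq_0)
  show p1: "prime_seq (Suc 0) = 3" by (rule prime_seq_nextI[OF p0]) simp_all
  show p2: "prime_seq 2 = 5" by (rule prime_seq_nextI[OF p1]) simp_all
  show p3: "prime_seq 3 = 7" by (rule prime_seq_nextI[OF p2]) simp_all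
  show p4: "prime_seq 4 = 11" by (rule prime_seq_nextI[OF p3]) simp_all
  show p5: "prime_seq 5 = 13" by (rule prime_seq_nextI[OF p4]) simp_all
  show p6: "prime_seq 6 = 17" by (rule prime_seq_nextI[OF p5]) simp_all
  show p7: "prime_seq 7 = 19" by (rule prime_seq_nextI[OF p6]) simp_all
  show p8: "prime_seq 8 = 23" by (rule prime_seq_nextI[OF p7]) simp_all
  show p9: "prime_seq 9 = 29" by (rule prime_seq_nextI[OF p8]) simp_all
  show p10: "prime_seq 10 = 31" by (rule prime_seq_nextI[OF p9]) simp_all
  show p11: "prime_seq 11 = 37" by (rule prime_seq_nextI[OF p10]) simp_all
  show p12: "prime_seq 12 = 41" by (rule prime_seq_nextI[OF p11]) simp_all
  show p13: "prime_seq 13 = 43" by (rule prime_seq_nextI[OF p12]) simp_all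
  show p14: "prime_seq 14 = 47" by (rule prime_seq_nextI[OF p13]) simp_all
  show p15: "prime_seq 15 = 53" by (rule prime_seq_nextI[OF p14]) simp_all
  show p16: "prime_seq 16 = 59" by (rule prime_seq_nextI[OF p15]) simp_all
qed

lemma prime_seq_Suc_le_double: "prime_seq (Suc k) \<le> 2 * prime_seq k"
proof -
  obtain p where "prime p" "prime_seq k < p" "p \<le> 2 * prime_seq k"
    using bertrand[of "prime_seq k"] prime_ge_1_nat[OF prime_prime_seq] by blast
  then show ?thesis
    using prime_seq_Suc_le[of p k] by linarith
qed

lemma prime_seq_gap_ge_2:
  assumes "k > 0"
  shows "prime_seq k + 2 \<le> prime_seq (Suc k)"
proof -
  have "prime_seq k > 2"
    using assms enumerate_mono[of 0 k "{p::nat. prime p}"] primes_infinite by (simp add: prime_seq_0)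
  then have "odd (prime_seq k)" "odd (prime_seq (Suc k))"
    using prime_seq_less_Suc[of k] prime_odd_nat[OF prime_prime_seq] less_trans by blast+
  then have "prime_seq (Suc k) \<noteq> prime_seq k + 1"
    by auto
  then show ?thesis
    using prime_seq_less_Suc[of k] by linarith
qed

section \<open>The constant and its digits\<close>

text \<open>
  The Cantor series with base \<open>prime_seq\<close> and digits \<open>prime_seq (k + 1) - prime_seq k - 1\<close>. The digit
  bound is Bertrand's postulate; the lower bound \<open>0\<close> for the tails is strict, as is needed to
  read off ceilings.
\<close>

lemma scaled_prime_gaps_expansion:
  "\<exists>t :: nat \<Rightarrow> real. \<forall>k. 0 < t k \<and> t k \<le> 1 \<and>
    prime_seq k * t k = real (prime_seq (k + 1)) - prime_seq k - 1 + t (k + 1)"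
proof -
  define q where "q k = real (prime_seq k)" for k
  define a where "a k = q (Suc k) - q k - 1" for k
  have a_ge_0: "a k \<ge> 0" for k
    using prime_seq_less_Suc[of k] by (simp add: a_def q_def)
  have a_ge_1: "a (Suc k) \<ge> 1" for k
    using prime_seq_gap_ge_2[of "Suc k"] by (simp add: a_def q_def)
  have q_pos: "q k > 0" for k
    using prime_gt_0_nat[OF prime_prime_seq[of k]] by (simp add: q_def)
  have a_le: "a k \<le> q k - 1" for k
    using prime_seq_Suc_le_double[of k] by (simp add: a_def q_def)
  obtain t where t: "0 \<le> t k" "t k \<le> 1" "q k * t k = a k + t (k + 1)" for k
    using cantor_series_expansion[of q a] q_pos a_ge_0 a_le by metis
  \<comment> \<open>A vanishing tail forces all later digits to vanish. The digit following \<open>a k\<close> belongs to an odd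
    prime and is therefore positive, even for \<open>k = 0\<close>, where \<open>a 0 = 3 - 2 - 1 = 0\<close>.\<close>
  have "t k \<noteq> 0" for k
  proof
    assume "t k = 0"
    then have "t (Suc k) = 0"
      using t(3)[of k] t(1)[of "Suc k"] a_ge_0[of k] by simp
    then have "a (Suc k) = 0"
      using t(3)[of "Suc k"] t(1)[of "Suc (Suc k)"] a_ge_0[of "Suc k"] by simp
    with a_ge_1[of k] show False by simp
  qed
  then have pos: "0 < t k" for k
    using t(1)[of k] by (simp add: less_le)
  show ?thesis
    using pos t(2,3) unfolding a_def q_def by (intro exI[of _ t]) simp
qed

lemma decimal_digit_from_floor:
  assumes "\<lfloor>x * 10 ^ m\<rfloor> = N" "i \<le> m"
  shows "decimal_digit x i = N div 10 ^ (m - i) mod 10"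
proof -
  have "(10::real) ^ m = 10 ^ i * of_int (10 ^ (m - i))"
    using assms(2) by (simp flip: power_add)
  then have "x * 10 ^ i = x * 10 ^ m / of_int (10 ^ (m - i))"
    by simp
  then have "\<lfloor>x * 10 ^ i\<rfloor> = \<lfloor>x * 10 ^ m\<rfloor> div 10 ^ (m - i)"
    by (simp only:) (rule floor_divide_real_eq_div, simp)
  with assms(1) show ?thesis
    by (simp add: decimal_digit_def)
qed

theorem theorem1:
  shows "\<exists>h1::real.
    \<lfloor>h1\<rfloor> = 1 \<and>
    map (decimal_digit h1) [1..<20] = [2,1,4,8,2,0,8,0,5,5,2,4,3,3,3,7,4,6,9] \<and>
    (\<exists>h :: nat \<Rightarrow> real.
       h 1 = h1 \<and>
       (\<forall>n\<ge>2. h n = of_int \<lceil>h (n - 1)\<rceil> * (h (n - 1) - of_int \<lceil>h (n - 1)\<rceil> + 2)) \<and>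
       (\<forall>n\<ge>1. \<lceil>h n\<rceil> = int (nth_prime n)))"
proof -
  obtain t :: "nat \<Rightarrow> real" where t: "0 < t k" "t k \<le> 1"
    and rec: "prime_seq k * t k = real (prime_seq (k + 1)) - prime_seq k - 1 + t (k + 1)" for k
    using scaled_prime_gaps_expansion by blast
  define h where "h n = real (prime_seq (n - 1)) - 1 + t (n - 1)" for n
  have ceiling_h: "\<lceil>h n\<rceil> = int (prime_seq (n - 1))" for n
    using t[of "n - 1"] by (intro ceiling_unique) (simp_all add: h_def)
  have h_rec: "h n = of_int \<lceil>h (n - 1)\<rceil> * (h (n - 1) - of_int \<lceil>h (n - 1)\<rceil> + 2)" if "n \<ge> 2" for n
  proof -
    obtain k where n: "n = Suc (Suc k)"
      using \<open>n \<ge> 2\<close> by (auto simp: numeral_2_eq_2 dest: Suc_le_D)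
    have "h n = prime_seq k * (t k + 1)"
      using rec[of k] by (simp add: h_def n algebra_simps)
    also have "t k + 1 = h (n - 1) - of_int \<lceil>h (n - 1)\<rceil> + 2"
      unfolding ceiling_h by (simp add: h_def n)
    finally show ?thesis
      unfolding ceiling_h by (simp add: n)
  qed
  have floor_h: "\<lfloor>h 1 * 10 ^ 19\<rfloor> = 12148208055243337469"
  proof -
    have h1: "h 1 = 1 + t 0"
      by (simp add: h_def prime_seq_values)
    \<comment> \<open>The equations for \<open>t 0, \<dots>, t 15\<close> and \<open>0 < t 16 \<le> 1\<close> confine \<open>t 0\<close> to an interval of length
      \<open>1 / (2 * 3 * \<dots> * 53)\<close>.\<close>
    note rec' =
      rec[of 0] rec[of 1, unfolded one_add_one] rec[of 2] rec[of 3] rec[of 4]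
      rec[of 5] rec[of 6] rec[of 7] rec[of 8] rec[of 9]
      rec[of 10] rec[of 11] rec[of 12] rec[of 13] rec[of 14]
      rec[of 15]
    show ?thesis
      unfolding h1 using rec' t(2)[of 16] t(1)[of 16]
      by (intro floor_unique) (simp_all add: prime_seq_values)
  qed
  have "\<lfloor>h 1\<rfloor> = 1"
    using floor_h unfolding floor_eq_iff by simp
  moreover have "map (decimal_digit (h 1)) [1..<20] = [2,1,4,8,2,0,8,0,5,5,2,4,3,3,3,7,4,6,9]"
    using decimal_digit_from_floor[OF floor_h] by (simp add: upt_rec)
  ultimately show ?thesis
    using h_rec ceiling_h by (intro exI[of _ "h 1"] conjI exI[of _ h]) (simp_all add: nth_prime_def)
qed

end
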